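(* There exists a positive constant $C_1$ such that for every arithmetic progression $\mathcal{A} = \mathcal{A}(v,d)$ (with $v \geq 0$, $d > 0$) we have $g(\mathcal{A}^{(n)}) \geq C_1 n$ for all sufficiently large integers $n$, where how large $n$ must be depends only on $v/d$. In particular, one can take $C_1 = 1/\pi^2$: for every $v \geq 0$ and $d > 0$ there is $N$, depending only on $v/d$, such that $g(\mathcal{A}(v,d)^{(n)}) \geq n/\pi^2$ for all integers $n \geq N$.
   Context: For real $v \geq 0$ and $d > 0$, $\mathcal{A}(v,d) := \{v, v+d, v+2d, v+3d, \ldots\}$ is the arithmetic progression with first term $v$ and common difference $d$. For real $u > 0$ and $q > 1$, $\mathcal{G}(u,q) := \{u, uq, uq^2, uq^3, \ldots\}$ is the geometric progression with first term $u$ and ratio $q$. For a positive integer $n$, $\mathcal{A}^{(n)}$ denotes the set of the first $n$ terms of the arithmetic progression $\mathcal{A}$. For a finite set $\mathcal{S}$ of nonnegative real numbers, $g(\mathcal{S})$ denotes the least positive integer $h$ such that there exist $h$ geometric progressions $\mathcal{G}_1, \ldots, \mathcal{G}_h$ (each of the form $\mathcal{G}(u,q)$ with $u>0$, $q>1$) with $\mathcal{S} \subseteq \bigcup_{i=1}^h \mathcal{G}_i$. *)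

theory Defs
  imports Complex_Main "HOL-Library.Extended_Real"
begin

definition arith_prog_initial :: "real \<Rightarrow> real \<Rightarrow> nat \<Rightarrow> real set" where
  "arith_prog_initial v d n = (\<lambda>k. v + real k * d) ` {..<n}"

definition geom_prog :: "real \<Rightarrow> real \<Rightarrow> real set" where
  "geom_prog u q = range (\<lambda>k::nat. u * q ^ k)"

definition covered_by_geom_progs :: "real set \<Rightarrow> nat \<Rightarrow> bool" where
  "covered_by_geom_progs S h \<longleftrightarrow>
     (\<exists>u q :: nat \<Rightarrow> real. (\<forall>i<h. u i > 0 \<and> q i > 1) \<and>
        S \<subseteq> (\<Union>i<h. geom_prog (u i) (q i)))"

text \<open>A set containing \<open>0\<close> is not covered by any number of geometric progressions with
  positive first term.  The values are therefore extended naturals: the infimum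
  is the least admissible \<open>h\<close> if there is one, and \<open>\<infinity>\<close> (the infimum of the empty set)
  otherwise.\<close>

definition geom_cover_number :: "real set \<Rightarrow> enat" where
  "geom_cover_number S = Inf {enat h | h. h > 0 \<and> covered_by_geom_progs S h}"

end

theory Submission
  imports Defs "HOL-Computational_Algebra.Computational_Algebra"
begin

text \<open>After scaling, the arithmetic progression consists of the numbers \<open>r + k\<close> with
  \<open>r = v / d\<close>, and three terms of a geometric progression satisfy a multiplicative relation
  \<open>y ^ (s + t) = x ^ t * z ^ s\<close>.

  If \<open>r = a / m\<close> in lowest terms, this relation forces \<open>x = y\<close> when the integers \<open>m * (r + k)\<close>
  involved are squarefree, so a geometric progression contains at most two of those; at least
  \<open>2 * n / 9\<close> of the integers \<open>a + m * k\<close>, \<open>k < n\<close>, are squarefree for large \<open>n\<close>.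

  If \<open>r\<close> is irrational, the relation is algebraic over the rationals, so \<open>r\<close> may be replaced
  by a conjugate \<open>z \<noteq> r\<close>. Hence \<open>ln \<bar>z + k\<bar>\<close> is an affine function of \<open>ln (r + k)\<close>
  along a geometric progression, that is, the positive numbers \<open>x = r + k\<close> in question solve an
  equation \<open>x\<^sup>2 + 2 * B * x + C = A * x powr b\<close> with \<open>C = \<bar>z - r\<bar>\<^sup>2 \<noteq> 0\<close>. By Rolle's theorem
  there are at most three solutions.\<close>

section \<open>Cover numbers, counting, and relations inside a geometric progression\<close>

lemma ge_geom_cover_numberI:
  assumes "\<And>h. covered_by_geom_progs S h \<Longrightarrow> c \<le> real h"
  shows "ereal c \<le> ereal_of_enat (geom_cover_number S)"
proof -
  let ?H = "{enat h |h. h > 0 \<and> covered_by_geom_progs S h}"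
  show ?thesis
  proof (cases "?H = {}")
    case True
    then show ?thesis by (simp only: geom_cover_number_def) (simp add: Inf_enat_def)
  next
    case False
    \<comment> \<open>A nonempty set of extended naturals attains its infimum, so a bound valid for
      every admissible \<open>h\<close> passes to it.\<close>
    then have "Inf ?H \<in> ?H"
      by (metis (mono_tags, lifting) Inf_enat_def LeastI_ex equals0I)
    then show ?thesis using assms by (auto simp: geom_cover_number_def)
  qed
qed

lemma card_gt_obtain_increasing:
  fixes K :: "'a::linorder set"
  assumes "finite K" "m < card K"
  obtains f :: "nat \<Rightarrow> 'a" where "\<And>i. i \<le> m \<Longrightarrow> f i \<in> K"
    "\<And>i j. i < j \<Longrightarrow> j \<le> m \<Longrightarrow> f i < f j"
proof
  let ?xs = "sorted_list_of_set K"
  show "?xs ! i \<in> K" if "i \<le> m" for i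
    using that assms by (metis le_less_trans length_sorted_list_of_set nth_mem set_sorted_list_of_set)
  show "?xs ! i < ?xs ! j" if "i < j" "j \<le> m" for i j
    using that assms by (intro sorted_wrt_nth_less[OF strict_sorted_list_of_set]) auto
qed

lemma card_le_of_Union:
  assumes "S \<subseteq> (\<Union>i<h. B i)" "\<And>i. i < h \<Longrightarrow> finite (B i)" "\<And>i. i < h \<Longrightarrow> card (B i) \<le> c"
  shows "card S \<le> c * (h::nat)"
proof -
  have "card S \<le> card (\<Union>i<h. B i)"
    using assms by (intro card_mono) auto
  also have "\<dots> \<le> (\<Sum>i<h. card (B i))" by (rule card_UN_le) simp
  also have "\<dots> \<le> (\<Sum>i<h. c)" using assms(3) by (intro sum_mono) auto
  finally show ?thesis by (simp add: mult.commute)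
qed

lemma geom_prog_increasing:
  fixes x :: "nat \<Rightarrow> real"
  assumes "u > 0" "q > 1" "\<And>i. i \<le> m \<Longrightarrow> x i \<in> geom_prog u q"
    and "\<And>i j. i < j \<Longrightarrow> j \<le> m \<Longrightarrow> x i < x j"
  obtains k :: "nat \<Rightarrow> nat" where "\<And>i. i \<le> m \<Longrightarrow> x i = u * q ^ k i"
    "\<And>i j. i < j \<Longrightarrow> j \<le> m \<Longrightarrow> k i < k j"
proof -
  have "\<forall>i. \<exists>k. i \<le> m \<longrightarrow> x i = u * q ^ k" using assms(3) by (auto simp: geom_prog_def)
  then obtain k where k: "\<And>i. i \<le> m \<Longrightarrow> x i = u * q ^ k i" by metis
  have "k i < k j" if "i < j" "j \<le> m" for i j
    using assms(4)[OF that] that k[of i] k[of j] assms(1,2) by simp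
  with k show ?thesis by (rule that)
qed

text \<open>Eliminates the unknown \<open>u\<close> and \<open>q\<close>. The powers of
  \<open>q\<close> agree because \<open>k\<^sub>2 * (k\<^sub>3 - k\<^sub>1) = k\<^sub>1 * (k\<^sub>3
  - k\<^sub>2) + k\<^sub>3 * (k\<^sub>2 - k\<^sub>1)\<close>.\<close>

lemma geom_prog_relation:
  fixes u q :: real and k\<^sub>1 k\<^sub>2 k\<^sub>3 :: nat
  assumes "k\<^sub>1 \<le> k\<^sub>2" "k\<^sub>2 \<le> k\<^sub>3"
  shows "(u * q ^ k\<^sub>2) ^ (k\<^sub>3 - k\<^sub>1) = (u * q ^ k\<^sub>1) ^ (k\<^sub>3 - k\<^sub>2) * (u * q ^ k\<^sub>3) ^ (k\<^sub>2 - k\<^sub>1)"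
proof -
  obtain s where s: "k\<^sub>2 = k\<^sub>1 + s" using assms(1) le_Suc_ex by blast
  obtain t where t: "k\<^sub>3 = k\<^sub>1 + s + t" using assms(2) s le_Suc_ex by blast
  show ?thesis
    by (simp add: s t power_add power_mult_distrib mult_ac flip: power_mult)
qed


section \<open>Rational quotient: squarefree terms\<close>

text \<open>At each prime the multiplicity in \<open>y\<close> is a weighted mean, with positive
  weights, of those in \<open>x\<close> and \<open>z\<close>. All three are 0 or 1, and a mean that
  equals an extreme value forces both entries to equal it.\<close>

lemma squarefree_relation:
  fixes x y z s t :: nat
  assumes "squarefree x" "squarefree y" "squarefree z" and "s > 0" "t > 0"
    and rel: "y ^ (t + s) = x ^ t * z ^ s"
  shows "x = y"
proof (rule multiplicity_eq_nat)
  have nz: "x > 0" "y > 0" "z > 0" using assms(1-3) by (auto intro!: Nat.gr0I)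
  then show "x > 0" "y > 0" by auto
  fix p :: nat assume p: "prime p"
  have le: "multiplicity p x \<le> 1" "multiplicity p y \<le> 1" "multiplicity p z \<le> 1"
    using assms(1-3) p nz
    by (auto simp: squarefree_factorial_semiring'')
  have "(t + s) * multiplicity p y = t * multiplicity p x + s * multiplicity p z"
    using arg_cong[OF rel, of "multiplicity p"] p nz
    by (simp add: prime_elem_multiplicity_mult_distrib prime_elem_multiplicity_power_distrib)
  with le \<open>s > 0\<close> \<open>t > 0\<close> show "multiplicity p x = multiplicity p y"
    by (auto simp: le_Suc_eq)
qed

lemma card_geom_prog_squarefree_le:
  fixes a m :: nat
  assumes "u > 0" "q > 1" "m > 0"
  shows "card {k. k < n \<and> squarefree (a + m * k) \<and> real (a + m * k) \<in> geom_prog u q} \<le> 2"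
    (is "card ?K \<le> 2")
proof (rule ccontr)
  assume "\<not> ?thesis"
  then have "2 < card ?K" by simp
  then obtain f :: "nat \<Rightarrow> nat" where f: "\<And>i. i \<le> 2 \<Longrightarrow> f i \<in> ?K" "\<And>i j. i < j \<Longrightarrow> j \<le> 2 \<Longrightarrow> f i < f j"
    by (rule card_gt_obtain_increasing[rotated]) auto
  define x where "x i = a + m * f i" for i
  have x: "squarefree (x i)" "real (x i) \<in> geom_prog u q" if "i \<le> 2" for i
    using f(1)[OF that] by (auto simp: x_def)
  have x_less: "x i < x j" if "i < j" "j \<le> 2" for i j
    using f(2)[OF that] assms(3) by (simp add: x_def)
  obtain k where k: "\<And>i. i \<le> 2 \<Longrightarrow> real (x i) = u * q ^ k i"
      "\<And>i j. i < j \<Longrightarrow> j \<le> 2 \<Longrightarrow> k i < k j"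
    using geom_prog_increasing[OF assms(1,2), of 2 "\<lambda>i. real (x i)"] x x_less by auto
  have k_less: "k 0 < k 1" "k 1 < k 2" by (auto intro!: k(2))
  have "real (x 1) ^ (k 2 - k 0) = real (x 0) ^ (k 2 - k 1) * real (x 2) ^ (k 1 - k 0)"
    using geom_prog_relation[of "k 0" "k 1" "k 2" u q] k_less k(1)[of 0] k(1)[of 1] k(1)[of 2] by simp
  then have "real (x 1 ^ (k 2 - k 0)) = real (x 0 ^ (k 2 - k 1) * x 2 ^ (k 1 - k 0))" by simp
  then have "x 1 ^ (k 2 - k 0) = x 0 ^ (k 2 - k 1) * x 2 ^ (k 1 - k 0)"
    by (simp only: of_nat_eq_iff)
  moreover have "k 2 - k 0 = (k 2 - k 1) + (k 1 - k 0)" using k_less by simp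
  ultimately have "x 1 ^ ((k 2 - k 1) + (k 1 - k 0)) = x 0 ^ (k 2 - k 1) * x 2 ^ (k 1 - k 0)"
    by (simp only:)
  then have "x 0 = x 1"
    by (rule squarefree_relation[rotated -1]) (use k_less x(1) in simp_all)
  with x_less[of 0 1] show False by simp
qed

section \<open>Density of squarefree numbers in an arithmetic progression\<close>

lemma card_dvd_arith_prog_le:
  fixes a m D :: nat
  assumes "coprime D m" "D > 0"
  shows "card {k. k < n \<and> D dvd a + m * k} \<le> n div D + 1" (is "card ?K \<le> _")
proof -
  \<comment> \<open>As \<open>m\<close> is invertible modulo \<open>D\<close>, all indices in the
    set lie in one residue class modulo \<open>D\<close>, so the quotient determines the
    index.\<close>
  have "inj_on (\<lambda>k. k div D) ?K"
  proof (rule inj_onI)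
    fix k l assume kl: "k \<in> ?K" "l \<in> ?K" "k div D = l div D"
    then have "int D dvd int (a + m * k) - int (a + m * l)"
      by (intro dvd_diff) (simp_all only: mem_Collect_eq int_dvd_int_iff)
    also have "\<dots> = int m * (int k - int l)" by (simp add: algebra_simps)
    finally have "int D dvd int k - int l"
      using assms(1) by (simp add: coprime_dvd_mult_right_iff)
    then have "k mod D = l mod D"
      by (metis mod_eq_dvd_iff of_nat_mod of_nat_eq_iff)
    with kl(3) show "k = l" by (metis div_mult_mod_eq)
  qed
  moreover have "(\<lambda>k. k div D) ` ?K \<subseteq> {..n div D}" by (auto intro: div_le_mono)
  ultimately show ?thesis
    using card_inj_on_le[of "\<lambda>k. k div D" ?K "{..n div D}"] by simp
qed

text \<open>Compare \<open>1 / j\<^sup>2\<close> with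
  \<open>1 / ((j - 1/2) * (j + 1/2)) = 1 / (j - 1/2) - 1 / (j + 1/2)\<close>. From
  \<open>j = 2\<close> on this telescopes, starting at \<open>1 / (3/2) = 2/3\<close>; the induction
  keeps the subtracted end term.\<close>

lemma sum_inverse_squares_le: "(\<Sum>j=2..M. 1 / (real j)\<^sup>2) \<le> 2 / 3"
proof -
  have "(\<Sum>j=2..M. 1 / (real j)\<^sup>2) \<le> 2 / 3 - 1 / (real M + 1 / 2)" if "M \<ge> 1"
    using that
  proof (induction M rule: dec_induct)
    case base
    then show ?case by simp
  next
    case (step M)
    have "1 / (real (Suc M))\<^sup>2 \<le> 1 / ((real M + 1 / 2) * (real M + 3 / 2))"
      by (intro frac_le mult_pos_pos) (auto simp: power2_eq_square algebra_simps)
    also have "\<dots> = 1 / (real M + 1 / 2) - 1 / (real (Suc M) + 1 / 2)"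
      by (simp add: field_simps)
    finally have "1 / (real (Suc M))\<^sup>2 \<le> 1 / (real M + 1 / 2) - 1 / (real (Suc M) + 1 / 2)" .
    with step show ?case by simp
  qed
  moreover have "0 \<le> 1 / (real M + 1 / 2)" by simp
  ultimately have "(\<Sum>j=2..M. 1 / (real j)\<^sup>2) \<le> 2 / 3" if "M \<ge> 1" using that by linarith
  then show ?thesis by (cases "M \<ge> 1") simp_all
qed

text \<open>Union bound: a term that is not squarefree is divisible by \<open>p\<^sup>2\<close> for
  some \<open>p\<close> coprime to \<open>m\<close> with \<open>2 \<le> p \<le> n / 9\<close>. Each
  \<open>p\<close> excludes at most \<open>n / p\<^sup>2 + 1\<close> indices, in all at most
  \<open>2 * n / 3 + n / 9\<close>, which leaves \<open>2 * n / 9\<close>.\<close>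

lemma card_squarefree_arith_prog_ge:
  fixes a m n :: nat
  assumes "coprime a m" "a > 0" "m > 0" and n: "n \<ge> 81 * (a + m)"
  shows "2 * real n / 9 \<le> real (card {k. k < n \<and> squarefree (a + m * k)})" (is "_ \<le> real (card ?S)")
proof -
  define P where "P = {p \<in> {2..n div 9}. coprime p m}"
  define B where "B p = {k. k < n \<and> p\<^sup>2 dvd a + m * k}" for p
  have "k \<in> ?S \<union> (\<Union>p\<in>P. B p)" if "k < n" for k
  proof (cases "squarefree (a + m * k)")
    case False
    then obtain p where p: "prime p" "p\<^sup>2 dvd a + m * k"
      using \<open>a > 0\<close> by (auto simp: squarefree_factorial_semiring)
    have "\<not> p dvd m"
    proof
      assume "p dvd m"
      moreover have "p dvd a + m * k" using p(2) by (metis dvd_mult_left power2_eq_square)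
      ultimately have "p dvd a" by (simp add: dvd_add_left_iff)
      with \<open>p dvd m\<close> assms(1) p(1) show False
        by (metis coprime_common_divisor not_prime_unit)
    qed
    then have cop: "coprime p m" using p(1) by (simp add: prime_imp_coprime)
    have "p\<^sup>2 \<le> a + m * k" using p(2) \<open>a > 0\<close> by (intro dvd_imp_le) auto
    also have "\<dots> \<le> a * n + m * n" using that by (intro add_mono mult_le_mono) auto
    finally have "(9 * p)\<^sup>2 \<le> 81 * (a + m) * n" by (simp add: algebra_simps power_mult_distrib)
    \<comment> \<open>The threshold on \<open>n\<close> enters here: it brings \<open>p\<close> down
      to at most \<open>n / 9\<close>, so that the summands \<open>+ 1\<close> cost at most
      \<open>n / 9\<close> in total.\<close>
    also have "\<dots> \<le> n * n" using n by (intro mult_le_mono) auto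
    finally have "(9 * p)\<^sup>2 \<le> n\<^sup>2" by (simp only: power2_eq_square)
    then have "9 * p \<le> n" by (rule power2_le_imp_le) simp
    then have "p \<in> P" using p(1) cop by (auto simp: P_def prime_ge_2_nat)
    then show ?thesis using that p(2) by (auto simp: B_def)
  qed (use that in auto)
  then have "{..<n} \<subseteq> ?S \<union> (\<Union>p\<in>P. B p)" by blast
  moreover have fin: "finite P" "finite (B p)" for p by (auto simp: P_def B_def)
  ultimately have "n \<le> card (?S \<union> (\<Union>p\<in>P. B p))"
    using card_mono[of "?S \<union> (\<Union>p\<in>P. B p)" "{..<n}"] by auto
  also have "\<dots> \<le> card ?S + card (\<Union>p\<in>P. B p)" by (rule card_Un_le)
  also have "card (\<Union>p\<in>P. B p) \<le> (\<Sum>p\<in>P. card (B p))" using fin by (intro card_UN_le)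
  finally have "real n \<le> real (card ?S) + (\<Sum>p\<in>P. real (card (B p)))"
    by (simp flip: of_nat_sum of_nat_add)
  also have "(\<Sum>p\<in>P. real (card (B p))) \<le> (\<Sum>p\<in>P. real n * (1 / (real p)\<^sup>2) + 1)"
  proof (rule sum_mono)
    fix p assume "p \<in> P"
    then have "card (B p) \<le> n div p\<^sup>2 + 1"
      unfolding B_def P_def by (intro card_dvd_arith_prog_le) auto
    then have "real (card (B p)) \<le> real (n div p\<^sup>2) + 1" by linarith
    also have "real (n div p\<^sup>2) \<le> real n / real (p\<^sup>2)" by (rule of_nat_div_le_of_nat)
    finally show "real (card (B p)) \<le> real n * (1 / (real p)\<^sup>2) + 1" by simp
  qed
  also have "\<dots> \<le> (\<Sum>p=2..n div 9. real n * (1 / (real p)\<^sup>2) + 1)"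
    by (rule sum_mono2) (auto simp: P_def)
  also have "\<dots> = real n * (\<Sum>p=2..n div 9. 1 / (real p)\<^sup>2) + real (n div 9 - 1)"
    by (simp add: sum.distrib sum_distrib_left)
  also have "\<dots> \<le> real n * (2 / 3) + real n / 9"
    by (intro add_mono mult_left_mono sum_inverse_squares_le) auto
  finally show ?thesis by simp
qed


section \<open>Irrational quotient: passing to a conjugate\<close>

text \<open>The type of the evaluation point is left open, so that one rational polynomial can be
  evaluated both at the real \<open>r\<close> and at its complex conjugates.\<close>

abbreviation rpoly :: "rat poly \<Rightarrow> 'a::field_char_0 \<Rightarrow> 'a" where
  "rpoly p \<equiv> poly (map_poly of_rat p)"

lemma rpoly_pCons: "rpoly (pCons c p) x = of_rat c + x * rpoly p x"
  by (simp add: map_poly_pCons)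

lemma rpoly_add: "rpoly (p + q) x = rpoly p x + rpoly q x"
  by (induction p q rule: poly_induct2) (simp_all add: rpoly_pCons of_rat_add algebra_simps)

lemma rpoly_smult: "rpoly (smult c p) x = of_rat c * rpoly p x"
  by (induction p) (simp_all add: rpoly_pCons of_rat_mult algebra_simps)

lemma rpoly_mult: "rpoly (p * q) x = rpoly p x * rpoly q x"
  by (induction p) (simp_all add: rpoly_pCons rpoly_add rpoly_smult algebra_simps)

lemma rpoly_diff: "rpoly (p - q) x = rpoly p x - rpoly q x"
  using rpoly_add[of "p - q" q x] by simp

lemma rpoly_power: "rpoly (p ^ n) x = rpoly p x ^ n"
  by (induction n) (simp_all add: rpoly_mult map_poly_1)

lemma rpoly_linear: "rpoly [:of_nat a, 1:] x = x + of_nat a"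
  by (simp add: rpoly_pCons)

lemma rpoly_of_rat: "rpoly p (of_rat c) = of_rat (poly p c)"
  by (induction p) (simp_all add: rpoly_pCons of_rat_add of_rat_mult)

lemma rpoly_of_real: "rpoly p (complex_of_real x) = complex_of_real (rpoly p x)"
proof (induction p)
  case (pCons c p)
  have "complex_of_rat c = complex_of_real (of_rat c)" by (cases c) (simp add: of_rat_rat)
  with pCons show ?case by (simp add: rpoly_pCons)
qed simp

lemma pderiv_map_poly_of_rat:
  "pderiv (map_poly of_rat p) = (map_poly of_rat (pderiv p) :: 'a::field_char_0 poly)"
  by (rule poly_eqI) (simp add: coeff_pderiv coeff_map_poly of_rat_mult of_rat_add)

text \<open>A nonzero rational polynomial \<open>f\<close> of least degree vanishing at
  \<open>r\<close> divides every other such polynomial, so any root of \<open>f\<close> inherits all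
  rational relations of \<open>r\<close>. Irrationality of \<open>r\<close> gives \<open>f\<close>
  degree at least 2 and excludes rational roots.\<close>

lemma irrational_algebraic_conjugate:
  fixes r :: real
  assumes irr: "r \<notin> \<rat>" and p: "p \<noteq> 0" "rpoly p r = 0"
  obtains z :: complex where "z \<noteq> of_real r" "z \<notin> \<rat>"
    "\<And>g. rpoly g r = 0 \<Longrightarrow> rpoly g z = 0"
proof -
  let ?P = "\<lambda>f. f \<noteq> 0 \<and> rpoly f r = 0"
  obtain f where f: "f \<noteq> 0" "rpoly f r = 0" and min: "\<And>g. ?P g \<Longrightarrow> degree f \<le> degree g"
    using ex_has_least_nat[of ?P p degree] p by blast
  have dvd: "f dvd g" if "rpoly g r = 0" for g
  proof -
    have "rpoly (g mod f) r = 0"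
      using that f(2) by (simp add: rpoly_diff rpoly_mult flip: minus_div_mult_eq_mod)
    then have "g mod f = 0"
      using min[of "g mod f"] degree_mod_less'[OF f(1), of g] by fastforce
    then show ?thesis by blast
  qed
  have deg: "degree f > 0"
  proof (rule Nat.gr0I)
    assume "degree f = 0"
    then obtain c where "f = [:c:]" by (rule degree_eq_zeroE)
    with f show False by (simp add: rpoly_pCons)
  qed
  \<comment> \<open>Splitting off a rational root would leave a factor of smaller degree that still
    vanishes at \<open>r\<close>.\<close>
  have no_rat_root: "poly f c \<noteq> 0" for c
  proof
    assume "poly f c = 0"
    then obtain g where g: "f = [:- c, 1:] * g" by (auto simp: poly_eq_0_iff_dvd)
    with f(1) have "g \<noteq> 0" by auto
    moreover have "rpoly g r = 0"
    proof -
      have "(r - of_rat c) * rpoly g r = 0"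
        using f(2) unfolding g rpoly_mult by (simp add: rpoly_pCons of_rat_minus)
      moreover have "r \<noteq> of_rat c" using irr by auto
      ultimately show ?thesis by simp
    qed
    ultimately have "degree f \<le> degree g" using min by blast
    moreover have "degree f = Suc (degree g)"
      unfolding g using \<open>g \<noteq> 0\<close> by (subst degree_mult_eq) auto
    ultimately show False by simp
  qed
  \<comment> \<open>Over the complex numbers, a root of the cofactor \<open>G\<close> of
    \<open>X - r\<close> serves as the conjugate.\<close>
  define F where "F = (map_poly of_rat f :: complex poly)"
  have degF: "degree F = degree f" unfolding F_def by (rule degree_map_poly) auto
  have "poly F (of_real r) = 0" using f(2) by (simp add: F_def rpoly_of_real)
  then obtain G where G: "F = [:- of_real r, 1:] * G" by (auto simp: poly_eq_0_iff_dvd)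
  have "F \<noteq> 0" using degF deg by auto
  with G have "G \<noteq> 0" by auto
  then have degG: "degree F = Suc (degree G)" unfolding G by (subst degree_mult_eq) auto
  have "degree G \<noteq> 0"
  proof
    assume "degree G = 0"
    then have "degree f = 1" using degF degG by simp
    then obtain c e where ce: "f = [:c, e:]" "e \<noteq> 0"
      by (metis One_nat_def degree_eq_zeroE degree_pCons_0 degree_pCons_eq_if f(1) nat.inject pCons_cases zero_neq_one pCons_eq_0_iff)
    then have "poly f (- c / e) = 0" by simp
    with no_rat_root show False by blast
  qed
  then have "\<not> constant (poly G)" by (simp add: constant_degree)
  then obtain z where z: "poly G z = 0" using fundamental_theorem_of_algebra by blast
  have Fz: "rpoly f z = 0" using z G by (simp flip: F_def)
  show ?thesis
  proof
    \<comment> \<open>Otherwise \<open>r\<close> is a double root, and the derivative of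
      \<open>f\<close> contradicts the minimality of its degree.\<close>
    show "z \<noteq> of_real r"
    proof
      assume "z = of_real r"
      then have "poly (pderiv F) (of_real r) = 0" using z unfolding G pderiv_mult by (simp add: pderiv_pCons)
      then have "rpoly (pderiv f) r = 0"
        by (simp add: F_def pderiv_map_poly_of_rat rpoly_of_real)
      moreover have "pderiv f \<noteq> 0" using deg by (simp add: pderiv_eq_0_iff)
      ultimately show False using min[of "pderiv f"] deg by (simp add: degree_pderiv)
    qed
    show "z \<notin> \<rat>"
    proof
      assume "z \<in> \<rat>"
      then obtain c where "z = of_rat c" by (rule Rats_cases)
      with Fz no_rat_root[of c] show False by (simp add: rpoly_of_rat)
    qed
    show "rpoly g z = 0" if "rpoly g r = 0" for g
      using dvd[OF that] Fz by (auto simp: rpoly_mult elim!: dvdE)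
  qed
qed

section \<open>Zeros of a quadratic minus a power function\<close>

lemma Rolle_pos:
  fixes f f' :: "real \<Rightarrow> real"
  assumes "\<And>x. x > 0 \<Longrightarrow> (f has_real_derivative f' x) (at x)" "0 < a" "a < b" "f a = 0" "f b = 0"
  obtains c where "a < c" "c < b" "f' c = 0"
proof -
  have "\<exists>c. a < c \<and> c < b \<and> f b - f a = (b - a) * f' c"
    using assms by (intro MVT2) auto
  then show ?thesis using assms that by auto
qed

text \<open>Rolle's theorem turns four zeros of the difference into one zero of its third
  derivative, which is a single power term. This forces \<open>b = 2\<close> and
  \<open>A = 1\<close>, and the linear equation that remains has two solutions.\<close>

lemma quadratic_eq_powr_zeros:
  fixes A B C b :: real
  assumes "0 < x\<^sub>1" "x\<^sub>1 < x\<^sub>2" "x\<^sub>2 < x\<^sub>3" "x\<^sub>3 < x\<^sub>4"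
    and eq: "\<And>x. x \<in> {x\<^sub>1, x\<^sub>2, x\<^sub>3, x\<^sub>4} \<Longrightarrow> x\<^sup>2 + 2 * B * x + C = A * x powr b"
  shows "C = 0"
proof -
  define f\<^sub>0 where "f\<^sub>0 x = x\<^sup>2 + 2 * B * x + C - A * x powr b" for x
  define f\<^sub>1 where "f\<^sub>1 x = 2 * x + 2 * B - A * b * x powr (b - 1)" for x
  define f\<^sub>2 where "f\<^sub>2 x = 2 - A * b * (b - 1) * x powr (b - 2)" for x
  define f\<^sub>3 where "f\<^sub>3 x = - (A * b * (b - 1) * (b - 2) * x powr (b - 3))" for x
  have d0: "(f\<^sub>0 has_real_derivative f\<^sub>1 x) (at x)" if "x > 0" for x
    unfolding f\<^sub>0_def f\<^sub>1_def using that by (auto intro!: derivative_eq_intros)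
  have d1: "(f\<^sub>1 has_real_derivative f\<^sub>2 x) (at x)" if "x > 0" for x
    unfolding f\<^sub>1_def f\<^sub>2_def using that by (auto intro!: derivative_eq_intros)
  have d2: "(f\<^sub>2 has_real_derivative f\<^sub>3 x) (at x)" if "x > 0" for x
    unfolding f\<^sub>2_def f\<^sub>3_def using that by (auto intro!: derivative_eq_intros)
  have f0: "f\<^sub>0 x\<^sub>1 = 0" "f\<^sub>0 x\<^sub>2 = 0" "f\<^sub>0 x\<^sub>3 = 0" "f\<^sub>0 x\<^sub>4 = 0"
    using eq by (auto simp: f\<^sub>0_def)
  obtain y\<^sub>1 where y1: "x\<^sub>1 < y\<^sub>1" "y\<^sub>1 < x\<^sub>2" "f\<^sub>1 y\<^sub>1 = 0"
    using Rolle_pos[of f\<^sub>0 f\<^sub>1 x\<^sub>1 x\<^sub>2] d0 f0 assms by auto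
  obtain y\<^sub>2 where y2: "x\<^sub>2 < y\<^sub>2" "y\<^sub>2 < x\<^sub>3" "f\<^sub>1 y\<^sub>2 = 0"
    using Rolle_pos[of f\<^sub>0 f\<^sub>1 x\<^sub>2 x\<^sub>3] d0 f0 assms by auto
  obtain y\<^sub>3 where y3: "x\<^sub>3 < y\<^sub>3" "y\<^sub>3 < x\<^sub>4" "f\<^sub>1 y\<^sub>3 = 0"
    using Rolle_pos[of f\<^sub>0 f\<^sub>1 x\<^sub>3 x\<^sub>4] d0 f0 assms by auto
  obtain z\<^sub>1 where z1: "y\<^sub>1 < z\<^sub>1" "z\<^sub>1 < y\<^sub>2" "f\<^sub>2 z\<^sub>1 = 0"
    using Rolle_pos[of f\<^sub>1 f\<^sub>2 y\<^sub>1 y\<^sub>2] d1 y1 y2 assms by auto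
  obtain z\<^sub>2 where z2: "y\<^sub>2 < z\<^sub>2" "z\<^sub>2 < y\<^sub>3" "f\<^sub>2 z\<^sub>2 = 0"
    using Rolle_pos[of f\<^sub>1 f\<^sub>2 y\<^sub>2 y\<^sub>3] d1 y2 y3 assms by auto
  obtain w where w: "z\<^sub>1 < w" "w < z\<^sub>2" "f\<^sub>3 w = 0"
    using Rolle_pos[of f\<^sub>2 f\<^sub>3 z\<^sub>1 z\<^sub>2] d2 z1 z2 y1 assms by auto
  have pos: "w > 0" "z\<^sub>1 > 0" using w z1 y1 assms by auto
  \<comment> \<open>Otherwise \<open>f\<^sub>2\<close> is the constant 2. Hence only the factor
    \<open>b - 2\<close> of \<open>f\<^sub>3\<close> can vanish.\<close>
  have "A * b * (b - 1) \<noteq> 0" using z1(3) by (auto simp: f\<^sub>2_def)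
  then have b: "b = 2" using w(3) pos by (auto simp: f\<^sub>3_def)
  then have "A = 1" using z1(3) pos by (simp add: f\<^sub>2_def)
  have lin: "2 * B * x + C = 0" if "x \<in> {x\<^sub>1, x\<^sub>2}" for x
  proof -
    have "x > 0" using that assms by auto
    then show ?thesis using eq[of x] that b \<open>A = 1\<close> by (auto simp: powr_numeral)
  qed
  have "2 * B * (x\<^sub>2 - x\<^sub>1) = (2 * B * x\<^sub>2 + C) - (2 * B * x\<^sub>1 + C)" by (simp add: algebra_simps)
  also have "\<dots> = 0" by (simp only: lin insertI1 insertI2 diff_self)
  finally have "B = 0" using assms(2) by simp
  then show ?thesis using lin[of x\<^sub>1] by simp
qed

text \<open>With \<open>x = u * q ^ k\<close> the exponent \<open>k\<close> is affine in
  \<open>ln x\<close> with slope \<open>1 / ln q\<close>. Exponentiating an affine function of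
  \<open>k\<close> therefore gives a constant times \<open>x powr (c / ln q)\<close>.\<close>

lemma log_affine_eq_powr:
  fixes w u q :: real and k k\<^sub>1 :: nat
  assumes "u > 0" "q > 1" "w > 0" "w\<^sub>1 > 0"
    and "ln w = ln w\<^sub>1 + c * (real k - real k\<^sub>1)"
  shows "w = w\<^sub>1 * (u * q ^ k\<^sub>1) powr (- (c / ln q)) * (u * q ^ k) powr (c / ln q)"
proof -
  define b where "b = c / ln q"
  have "c = b * ln q" using assms(2) by (simp add: b_def)
  then have "ln w = ln (w\<^sub>1 * (u * q ^ k\<^sub>1) powr (- b) * (u * q ^ k) powr b)"
    using assms by (simp add: ln_mult ln_powr ln_realpow algebra_simps)
  moreover have "w\<^sub>1 * (u * q ^ k\<^sub>1) powr (- b) * (u * q ^ k) powr b > 0" using assms by simp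
  ultimately show ?thesis using assms(3) by (simp only: ln_inj_iff b_def)
qed

lemma card_geom_prog_irrational_le:
  fixes r :: real
  assumes u: "u > 0" and q: "q > 1" and r: "r \<ge> 0" "r \<notin> \<rat>"
  shows "card {k. k < n \<and> r + real k \<in> geom_prog u q} \<le> 3" (is "card ?K \<le> 3")
proof (rule ccontr)
  assume "\<not> ?thesis"
  then have "3 < card ?K" by simp
  then obtain a :: "nat \<Rightarrow> nat" where a: "\<And>i. i \<le> 3 \<Longrightarrow> a i \<in> ?K" "\<And>i j. i < j \<Longrightarrow> j \<le> 3 \<Longrightarrow> a i < a j"
    by (rule card_gt_obtain_increasing[rotated]) auto
  define x where "x i = r + real (a i)" for i
  have x_less: "x i < x j" if "i < j" "j \<le> 3" for i j
    using a(2)[OF that] by (simp add: x_def)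
  have "r \<noteq> 0" using r(2) by auto
  then have x_pos: "x i > 0" for i using r(1) by (simp add: x_def add_pos_nonneg)
  obtain k where k: "\<And>i. i \<le> 3 \<Longrightarrow> x i = u * q ^ k i"
      "\<And>i j. i < j \<Longrightarrow> j \<le> 3 \<Longrightarrow> k i < k j"
    using geom_prog_increasing[OF u q, of 3 x] a x_less by (auto simp: x_def)
  have k01: "k 0 < k 1" by (rule k(2)) auto
  \<comment> \<open>\<open>p i\<close> encodes the relation between terms 0, 1 and \<open>i\<close>
    as a polynomial in \<open>r\<close>; it vanishes at \<open>r\<close> for \<open>i = 2\<close>
    and \<open>i = 3\<close>.\<close>
  define p where "p i = [:of_nat (a 1), 1:] ^ (k i - k 0)
      - [:of_nat (a 0), 1:] ^ (k i - k 1) * [:of_nat (a i), 1:: rat:] ^ (k 1 - k 0)" for i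
  have rp: "rpoly (p i) y = (y + of_nat (a 1)) ^ (k i - k 0)
      - (y + of_nat (a 0)) ^ (k i - k 1) * (y + of_nat (a i)) ^ (k 1 - k 0)"
    for i and y :: "'b::field_char_0"
    by (simp add: p_def rpoly_diff rpoly_mult rpoly_power rpoly_linear)
  have pr: "rpoly (p i) r = 0" if "1 < i" "i \<le> 3" for i
  proof -
    have "k 1 < k i" using that by (intro k(2)) auto
    then show ?thesis
      using geom_prog_relation[of "k 0" "k 1" "k i" u q] k01 k(1)[of 0] k(1)[of 1] k(1)[of i] that
      by (simp add: rp x_def)
  qed
  \<comment> \<open>This makes \<open>r\<close> algebraic. At \<open>- a 0\<close> the product
    vanishes, whereas the other power has the nonzero base \<open>a 1 - a 0\<close>.\<close>
  have "p 2 \<noteq> 0"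
  proof
    assume "p 2 = 0"
    then have "rpoly (p 2) (- real (a 0)) = 0" by simp
    moreover have "k 1 < k 2" "a 0 < a 1" by (auto intro: k(2) a(2))
    ultimately show False using k01 by (simp add: rp power_0_left)
  qed
  then obtain z where z: "z \<noteq> complex_of_real r" "z \<notin> \<rat>"
      "\<And>g. rpoly g r = 0 \<Longrightarrow> rpoly g z = 0"
    using irrational_algebraic_conjugate[OF r(2) _ pr[of 2]] by auto
  define w where "w i = (cmod (z + of_nat (a i)))\<^sup>2" for i
  have "z + of_nat (a i) \<noteq> 0" for i
  proof
    assume "z + of_nat (a i) = 0"
    then have "z = - of_nat (a i)" by (simp add: add_eq_0_iff2)
    with z(2) show False by simp
  qed
  then have w_pos: "w i > 0" for i by (simp add: w_def)
  \<comment> \<open>The relation holds for the conjugate \<open>z\<close> as well; squared moduli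
    and logarithms make it linear.\<close>
  have w_rel: "real (k i - k 0) * ln (w 1) = real (k i - k 1) * ln (w 0) + real (k 1 - k 0) * ln (w i)"
    if "1 < i" "i \<le> 3" for i
  proof -
    have "(z + of_nat (a 1)) ^ (k i - k 0)
        = (z + of_nat (a 0)) ^ (k i - k 1) * (z + of_nat (a i)) ^ (k 1 - k 0)"
      using z(3)[OF pr[OF that]] by (simp add: rp)
    from arg_cong[OF this, of "\<lambda>y. (cmod y)\<^sup>2"]
    have "w 1 ^ (k i - k 0) = w 0 ^ (k i - k 1) * w i ^ (k 1 - k 0)"
      by (simp add: w_def norm_mult norm_power power_mult_distrib flip: power_mult)
         (simp add: mult.commute)
    from arg_cong[OF this, of ln] show ?thesis
      using w_pos by (simp add: ln_mult_pos ln_realpow)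
  qed
  \<comment> \<open>The slope is read off from the indices 0 and 1; the relations place the other
    points on the same line.\<close>
  define c where "c = (ln (w 1) - ln (w 0)) / (real (k 1) - real (k 0))"
  have affine: "ln (w i) = ln (w 0) + c * (real (k i) - real (k 0))" if "i \<le> 3" for i
  proof -
    consider "i = 0" | "i = 1" | "1 < i" by linarith
    then show ?thesis
    proof cases
      case 3
      then have ki: "k 1 < k i" using that by (intro k(2)) auto
      have "(real (k i) - real (k 0)) * ln (w 1)
          = (real (k i) - real (k 1)) * ln (w 0) + (real (k 1) - real (k 0)) * ln (w i)"
        using w_rel[OF 3 that] ki k01 by (simp add: of_nat_diff)
      then show ?thesis using k01 by (simp add: c_def field_simps)
    qed (use k01 in \<open>simp_all add: c_def\<close>)
  qed
  define A where "A = w 0 * (u * q ^ k 0) powr (- (c / ln q))"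
  \<comment> \<open>Since \<open>z + a i = (z - r) + x i\<close> with \<open>x i\<close> real, the
    squared modulus expands to \<open>(x i)\<^sup>2 + 2 * B * x i + C\<close>.\<close>
  define B where "B = Re z - r"
  define C where "C = (cmod (z - of_real r))\<^sup>2"
  have eq: "(x i)\<^sup>2 + 2 * B * x i + C = A * x i powr (c / ln q)" if "i \<le> 3" for i
  proof -
    have "w i = A * x i powr (c / ln q)"
      using log_affine_eq_powr[OF u q w_pos w_pos affine[OF that]] k(1)[OF that] by (simp add: A_def)
    moreover have "w i = (x i)\<^sup>2 + 2 * B * x i + C"
      by (simp add: w_def x_def B_def C_def cmod_power2) (simp add: power2_eq_square algebra_simps)
    ultimately show ?thesis by simp
  qed
  have "C = 0"
  proof (rule quadratic_eq_powr_zeros)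
    show "0 < x 0" by (rule x_pos)
    show "x 0 < x 1" "x 1 < x 2" "x 2 < x 3" by (auto intro: x_less)
    show "y\<^sup>2 + 2 * B * y + C = A * y powr (c / ln q)" if "y \<in> {x 0, x 1, x 2, x 3}" for y
      using that eq[of 0] eq[of 1] eq[of 2] eq[of 3] by auto
  qed
  with z(1) show False by (simp add: C_def)
qed


section \<open>The lower bound\<close>

text \<open>Scaling by \<open>e / d\<close> preserves ratios and makes the cover depend on
  \<open>v / d\<close>. The factor \<open>e\<close> is 1 in the irrational case and clears the
  denominator in the rational one.\<close>

lemma covered_arith_prog_initialE:
  assumes "covered_by_geom_progs (arith_prog_initial v d n) h" "d > 0" "e > 0"
  obtains u q where "\<And>i. i < h \<Longrightarrow> u i > 0 \<and> q i > 1"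
    "\<And>k. k < n \<Longrightarrow> \<exists>i<h. e * (v / d + real k) \<in> geom_prog (u i) (q i)"
proof -
  obtain u q where uq: "\<And>i. i < h \<Longrightarrow> u i > 0 \<and> q i > 1"
      "arith_prog_initial v d n \<subseteq> (\<Union>i<h. geom_prog (u i) (q i))"
    using assms(1) by (auto simp: covered_by_geom_progs_def)
  show ?thesis
  proof
    show "e / d * u i > 0 \<and> q i > 1" if "i < h" for i using uq(1)[OF that] assms(2,3) by simp
    show "\<exists>i<h. e * (v / d + real k) \<in> geom_prog (e / d * u i) (q i)" if k: "k < n" for k
    proof -
      have "v + real k * d \<in> arith_prog_initial v d n" using k by (auto simp: arith_prog_initial_def)
      then obtain i j where ij: "i < h" "v + real k * d = u i * q i ^ j"
        using uq(2) by (fastforce simp: geom_prog_def)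
      have "e * (v / d + real k) = e / d * (v + real k * d)" using assms(2) by (simp add: field_simps)
      also have "\<dots> = e / d * u i * q i ^ j" by (simp add: ij(2))
      finally show ?thesis using ij(1) by (auto simp: geom_prog_def)
    qed
  qed
qed

lemma covered_irrational:
  assumes "covered_by_geom_progs (arith_prog_initial v d n) h" "v \<ge> 0" "d > 0" "v / d \<notin> \<rat>"
  shows "n \<le> 3 * h"
proof -
  obtain u q where uq: "\<And>i. i < h \<Longrightarrow> u i > 0 \<and> q i > 1"
      "\<And>k. k < n \<Longrightarrow> \<exists>i<h. v / d + real k \<in> geom_prog (u i) (q i)"
    using covered_arith_prog_initialE[OF assms(1,3), of 1] by auto
  have "card {..<n} \<le> 3 * h"
  proof (rule card_le_of_Union)
    show "{..<n} \<subseteq> (\<Union>i<h. {k. k < n \<and> v / d + real k \<in> geom_prog (u i) (q i)})"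
      using uq(2) by auto
    show "card {k. k < n \<and> v / d + real k \<in> geom_prog (u i) (q i)} \<le> 3" if "i < h" for i
      using uq(1)[OF that] assms by (intro card_geom_prog_irrational_le) auto
  qed auto
  then show ?thesis by simp
qed

text \<open>Each progression takes at most 2 of the at least \<open>2 * n / 9\<close> squarefree
  terms.\<close>

lemma covered_rational:
  fixes a m :: nat
  assumes "covered_by_geom_progs (arith_prog_initial v d n) h" "d > 0" "v / d = real a / real m"
    and "coprime a m" "a > 0" "m > 0" "n \<ge> 81 * (a + m)"
  shows "n \<le> 9 * h"
proof -
  obtain u q where uq: "\<And>i. i < h \<Longrightarrow> u i > 0 \<and> q i > 1"
      "\<And>k. k < n \<Longrightarrow> \<exists>i<h. real m * (v / d + real k) \<in> geom_prog (u i) (q i)"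
    using covered_arith_prog_initialE[OF assms(1,2), of "real m"] assms(6) by auto
  have scale: "real m * (v / d + real k) = real (a + m * k)" for k
    using assms(6) by (simp add: assms(3) field_simps)
  have "card {k. k < n \<and> squarefree (a + m * k)} \<le> 2 * h"
  proof (rule card_le_of_Union)
    show "{k. k < n \<and> squarefree (a + m * k)}
        \<subseteq> (\<Union>i<h. {k. k < n \<and> squarefree (a + m * k) \<and> real (a + m * k) \<in> geom_prog (u i) (q i)})"
      using uq(2) unfolding scale by blast
    show "card {k. k < n \<and> squarefree (a + m * k) \<and> real (a + m * k) \<in> geom_prog (u i) (q i)} \<le> 2"
      if "i < h" for i
      using uq(1)[OF that] assms(6) by (intro card_geom_prog_squarefree_le) auto
  qed auto
  with card_squarefree_arith_prog_ge[OF assms(4-7)] show ?thesis by linarith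
qed

text \<open>The term 0 lies in no geometric progression with positive first term, so for
  \<open>r = 0\<close> the lower bound holds vacuously.\<close>

lemma not_covered_zero:
  assumes "n > 0" shows "\<not> covered_by_geom_progs (arith_prog_initial 0 d n) h"
proof
  assume "covered_by_geom_progs (arith_prog_initial 0 d n) h"
  moreover have "0 \<in> arith_prog_initial 0 d n" using assms by (force simp: arith_prog_initial_def)
  ultimately obtain u q :: real and j :: nat where "u > 0" "q > 1" "0 = u * q ^ j"
    by (fastforce simp: covered_by_geom_progs_def geom_prog_def)
  then show False by simp
qed

text \<open>\<open>N\<close> is chosen before \<open>v\<close> and \<open>d\<close>, so it depends
  on \<open>r\<close> alone. Only a positive rational \<open>r\<close> needs a large threshold,
  which comes from its lowest terms.\<close>

lemma covered_arith_prog_initial_bound: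
  fixes r :: real
  shows "\<exists>N. \<forall>v d. v \<ge> 0 \<longrightarrow> d > 0 \<longrightarrow> v / d = r \<longrightarrow>
    (\<forall>n\<ge>N. \<forall>h. covered_by_geom_progs (arith_prog_initial v d n) h \<longrightarrow> n \<le> 9 * h)"
proof -
  consider "r < 0" | "r = 0" | "r \<notin> \<rat>" | "r > 0" "r \<in> \<rat>" by linarith
  then show ?thesis
  proof cases
    case 1
    then show ?thesis by (metis divide_nonneg_pos not_less)
  next
    case 2
    have "n \<le> 9 * h" if "d > 0" "v / d = r" "n \<ge> 1"
      "covered_by_geom_progs (arith_prog_initial v d n) h" for v d n h
      using that 2 not_covered_zero[of n d h] by simp
    then show ?thesis by blast
  next
    case 3
    have "n \<le> 9 * h" if "v \<ge> 0" "d > 0" "v / d = r"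
      "covered_by_geom_progs (arith_prog_initial v d n) h" for v d n h
      using covered_irrational[OF that(4,1,2)] that(3) 3 by simp
    then show ?thesis by blast
  next
    case 4
    obtain a m :: nat where am: "m \<noteq> 0" "\<bar>r\<bar> = real a / real m" "coprime a m"
      using Rats_abs_nat_div_natE[OF 4(2)] by metis
    with 4(1) have "r = real a / real m" "a > 0" "m > 0" by (auto intro: Nat.gr0I)
    then have "n \<le> 9 * h" if "d > 0" "v / d = r" "n \<ge> 81 * (a + m)"
      "covered_by_geom_progs (arith_prog_initial v d n) h" for v d n h
      using covered_rational[OF that(4,1)] that am(3) by blast
    then show ?thesis by blast
  qed
qed

theorem theorem1p1:
  shows "(\<exists>C\<^sub>1 :: real. C\<^sub>1 > 0 \<and>
            (\<exists>N :: real \<Rightarrow> nat. \<forall>v d :: real. v \<ge> 0 \<longrightarrow> d > 0 \<longrightarrow>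
               (\<forall>n \<ge> N (v / d).
                  ereal_of_enat (geom_cover_number (arith_prog_initial v d n))
                    \<ge> ereal (C\<^sub>1 * real n)))) \<and>
         (\<exists>N :: real \<Rightarrow> nat. \<forall>v d :: real. v \<ge> 0 \<longrightarrow> d > 0 \<longrightarrow>
            (\<forall>n \<ge> N (v / d).
               ereal_of_enat (geom_cover_number (arith_prog_initial v d n))
                 \<ge> ereal (real n / pi\<^sup>2)))"
proof -
  obtain N :: "real \<Rightarrow> nat" where N: "\<And>v d n h. v \<ge> 0 \<Longrightarrow> d > 0 \<Longrightarrow> n \<ge> N (v / d) \<Longrightarrow>
      covered_by_geom_progs (arith_prog_initial v d n) h \<Longrightarrow> n \<le> 9 * h"
    using covered_arith_prog_initial_bound by metis
  \<comment> \<open>\<open>sin (pi / 6) = 1/2\<close> is at most \<open>pi / 6\<close>. The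
    resulting \<open>9 \<le> pi\<^sup>2\<close> turns the constant \<open>1/9\<close> of the
    argument into \<open>1 / pi\<^sup>2\<close>.\<close>
  have "3 \<le> pi" using sin_x_le_x[of "pi / 6"] by (simp add: sin_30)
  then have "3\<^sup>2 \<le> pi\<^sup>2" by (intro power_mono) auto
  then have pi2: "9 \<le> pi\<^sup>2" by simp
  have bound: "ereal (real n / pi\<^sup>2) \<le> ereal_of_enat (geom_cover_number (arith_prog_initial v d n))"
    if "v \<ge> 0" "d > 0" "n \<ge> N (v / d)" for v d n
  proof (rule ge_geom_cover_numberI)
    fix h assume "covered_by_geom_progs (arith_prog_initial v d n) h"
    then have "real n \<le> 9 * real h" using N[OF that] by (metis of_nat_le_iff of_nat_mult of_nat_numeral)
    also have "\<dots> \<le> pi\<^sup>2 * real h" using pi2 by (intro mult_right_mono) auto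
    finally show "real n / pi\<^sup>2 \<le> real h" by (simp add: field_simps)
  qed
  then have "ereal (1 / pi\<^sup>2 * real n) \<le> ereal_of_enat (geom_cover_number (arith_prog_initial v d n))"
    if "v \<ge> 0" "d > 0" "n \<ge> N (v / d)" for v d n
    using that by simp
  moreover have "1 / pi\<^sup>2 > 0" by simp
  ultimately show ?thesis using bound by blast
qed

end
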